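(* Let $D\subset\mathbb{R}^n$ be a disk. There is a constant $c_2=c_2(D)>0$ such that if $Z$ is a $\mathcal{C}^1$ compact hypersurface contained in $D$, with reach $\rho(Z)>0$, then $$b(Z)\le c_2\cdot\left(1+\frac1{\rho(Z)}\right)^n.$$
   Context: A compact hypersurface is a closed (compact, without boundary) submanifold of $\mathbb{R}^n$ of codimension $1$. The reach of $Z$ is $\rho(Z)=\sup\{r>0:\mathrm{dist}(x,Z)<r\Rightarrow\exists!\,z\in Z\text{ with }\mathrm{dist}(x,Z)=\mathrm{dist}(x,z)\}$. $b(Z)$ is the sum of the Betti numbers of $Z$. $D$ is a closed ball. *)

theory Defs
  imports "HOL-Analysis.Analysis" "HOL-Homology.Homology"
begin

definition C1_on :: "'a::real_normed_vector set \<Rightarrow> ('a \<Rightarrow> 'b::real_normed_vector) \<Rightarrow> bool" where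
  "C1_on U f \<longleftrightarrow>
     (\<exists>f' :: 'a \<Rightarrow> 'a \<Rightarrow>\<^sub>L 'b.
        (\<forall>x\<in>U. (f has_derivative blinfun_apply (f' x)) (at x)) \<and> continuous_on U f')"

definition C1_diffeomorphism ::
    "'a::real_normed_vector set \<Rightarrow> 'b::real_normed_vector set \<Rightarrow> ('a \<Rightarrow> 'b) \<Rightarrow> ('b \<Rightarrow> 'a) \<Rightarrow> bool" where
  "C1_diffeomorphism U V f g \<longleftrightarrow>
     open U \<and> open V \<and> homeomorphism U V f g \<and> C1_on U f \<and> C1_on V g"

text \<open>Embedded submanifolds without boundary, given by slice charts: a chart flattens the
  submanifold onto an open piece of a \<open>d\<close>-dimensional linear subspace.\<close>

definition C1_submanifold :: "nat \<Rightarrow> 'a::euclidean_space set \<Rightarrow> bool" where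
  "C1_submanifold d Z \<longleftrightarrow>
     (\<forall>p\<in>Z. \<exists>U V f g (T :: 'a set). p \<in> U \<and> C1_diffeomorphism U V f g \<and>
        subspace T \<and> dim T = d \<and> f ` (Z \<inter> U) = V \<inter> T)"

definition C1_compact_hypersurface :: "'a::euclidean_space set \<Rightarrow> bool" where
  "C1_compact_hypersurface Z \<longleftrightarrow> compact Z \<and> C1_submanifold (DIM('a) - 1) Z"

text \<open>The reach may be infinite (a single point), so it is an extended nonnegative real.
  Since \<^term>\<open>infdist x {} = 0\<close> by library convention, the condition \<open>Z \<noteq> {}\<close> restores the usual
  reading of the distance to the empty set as infinite.\<close>

definition reach :: "'a::metric_space set \<Rightarrow> ennreal" where
  "reach Z = Sup {ennreal r | r. r > 0 \<and>
     (\<forall>x. Z \<noteq> {} \<and> infdist x Z < r \<longrightarrow> (\<exists>!z. z \<in> Z \<and> infdist x Z = dist x z))}"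

text \<open>The rank of an abelian group is the supremum of the sizes of its finite subsets that are
  linearly independent over the integers (the group operation is written multiplicatively).\<close>

definition int_independent :: "('a, 'b) monoid_scheme \<Rightarrow> 'a set \<Rightarrow> bool" where
  "int_independent G S \<longleftrightarrow> finite S \<and> S \<subseteq> carrier G \<and>
     (\<forall>c :: 'a \<Rightarrow> int. finprod G (\<lambda>x. x [^]\<^bsub>G\<^esub> c x) S = \<one>\<^bsub>G\<^esub> \<longrightarrow> (\<forall>x\<in>S. c x = 0))"

definition group_rank :: "('a, 'b) monoid_scheme \<Rightarrow> ennreal" where
  "group_rank G = (SUP S \<in> {S. int_independent G S}. of_nat (card S))"

text \<open>Betti numbers as ranks of the singular homology groups with integer coefficients.  Values in
  \<^typ>\<open>ennreal\<close> make an infinite rank, or an infinite sum of ranks, equal to infinity.\<close>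

definition betti :: "nat \<Rightarrow> 'a topology \<Rightarrow> ennreal" where
  "betti p X = group_rank (homology_group (int p) X)"

definition total_betti :: "'a::topological_space set \<Rightarrow> ennreal" where
  "total_betti Z = suminf (\<lambda>p. betti p (top_of_set Z))"

end

theory Submission
  imports Defs
begin

text \<open>Let \<open>r\<close> be smaller than the reach.  Cover \<open>Z\<close> by the open boxes of a grid of mesh
  proportional to \<open>r\<close> that meet \<open>Z\<close>.  Their union lies in the \<open>r\<close>-neighbourhood of \<open>Z\<close>, so
  nearest-point projection retracts it onto \<open>Z\<close> and its Betti numbers dominate those of \<open>Z\<close>.  Each
  box is convex and meets at most \<open>3 ^ n\<close> others, so by Mayer--Vietoris adding one box raises the
  sum of the Betti numbers by at most a constant depending on \<open>n\<close>; and at most a constant times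
  \<open>(1 / r) ^ n\<close> boxes meet \<open>D\<close>.\<close>

section \<open>Ranks of abelian groups\<close>

text \<open>Combinations run over indexed families rather than sets because a homomorphism may
  identify members: the images under \<open>g\<close> in \<open>group_rank_exact_le\<close> need not
  be distinct.\<close>

definition int_comb :: "('a, 'b) monoid_scheme \<Rightarrow> ('i \<Rightarrow> int) \<Rightarrow> ('i \<Rightarrow> 'a) \<Rightarrow> 'i set \<Rightarrow> 'a" where
  "int_comb G c x I = finprod G (\<lambda>i. x i [^]\<^bsub>G\<^esub> c i) I"

definition int_indep_family :: "('a, 'b) monoid_scheme \<Rightarrow> ('i \<Rightarrow> 'a) \<Rightarrow> 'i set \<Rightarrow> bool" where
  "int_indep_family G x I \<longleftrightarrow>
     (\<forall>c. int_comb G c x I = \<one>\<^bsub>G\<^esub> \<longrightarrow> (\<forall>i\<in>I. c i = 0))"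

context comm_group
begin

lemma int_comb_closed [simp]: "x \<in> I \<rightarrow> carrier G \<Longrightarrow> int_comb G c x I \<in> carrier G"
  by (auto simp: int_comb_def Pi_iff)

lemma int_comb_cong:
  assumes "x \<in> I \<rightarrow> carrier G" "\<And>i. i \<in> I \<Longrightarrow> c i = d i" "\<And>i. i \<in> I \<Longrightarrow> x i = y i"
  shows "int_comb G c x I = int_comb G d y I"
  unfolding int_comb_def by (rule finprod_cong') (use assms in \<open>auto simp: Pi_iff\<close>)

lemma int_comb_neutral:
  assumes "finite J" "I \<subseteq> J" "x \<in> J \<rightarrow> carrier G" "\<And>i. i \<in> J - I \<Longrightarrow> c i = 0"
  shows "int_comb G c x J = int_comb G c x I"
  unfolding int_comb_def
  by (rule finprod_mono_neutral_cong_right) (use assms in \<open>auto simp: Pi_iff\<close>)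

lemma int_comb_add:
  assumes "x \<in> I \<rightarrow> carrier G"
  shows "int_comb G (\<lambda>i. c i + d i) x I = int_comb G c x I \<otimes> int_comb G d x I"
proof -
  have "int_comb G (\<lambda>i. c i + d i) x I = finprod G (\<lambda>i. x i [^] c i \<otimes> x i [^] d i) I"
    unfolding int_comb_def
    by (rule finprod_cong') (use assms in \<open>auto simp: Pi_iff int_pow_mult\<close>)
  also have "\<dots> = int_comb G c x I \<otimes> int_comb G d x I"
    unfolding int_comb_def by (rule finprod_multf) (use assms in auto)
  finally show ?thesis .
qed

lemma int_comb_pow:
  assumes "finite I" "x \<in> I \<rightarrow> carrier G"
  shows "int_comb G c x I [^] (k::int) = int_comb G (\<lambda>i. k * c i) x I"
  using assms
proof (induction I)
  case (insert i I)
  then show ?case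
    by (simp add: int_comb_def int_pow_distrib int_pow_pow Pi_iff mult.commute)
qed (simp add: int_comb_def)

lemma int_comb_int_comb:
  assumes "finite S" "finite I" "x \<in> I \<rightarrow> carrier G"
  shows "int_comb G d (\<lambda>s. int_comb G (e s) x I) S = int_comb G (\<lambda>i. \<Sum>s\<in>S. d s * e s i) x I"
  using assms(1)
proof (induction S)
  case empty
  then show ?case
    by (auto simp: int_comb_def)
next
  case (insert s S)
  have "int_comb G d (\<lambda>s. int_comb G (e s) x I) (insert s S)
      = int_comb G (e s) x I [^] d s \<otimes> int_comb G d (\<lambda>s. int_comb G (e s) x I) S"
    unfolding int_comb_def[of G d]
    by (rule finprod_insert) (use insert assms in \<open>auto simp: Pi_iff\<close>)
  also have "\<dots> = int_comb G (\<lambda>i. d s * e s i + (\<Sum>s\<in>S. d s * e s i)) x I"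
    by (simp only: int_comb_pow[OF assms(2,3)] insert.IH int_comb_add[OF assms(3)])
  finally show ?case
    using insert by simp
qed

text \<open>If two indices had the same value, coefficients 1 and -1 at them and 0 elsewhere would
  form a nontrivial relation.\<close>

lemma int_indep_family_inj_on:
  assumes "finite I" "x \<in> I \<rightarrow> carrier G" "int_indep_family G x I"
  shows "inj_on x I"
proof (rule inj_onI, rule ccontr)
  fix i j
  assume ij: "i \<in> I" "j \<in> I" "x i = x j" "i \<noteq> j"
  define c :: "_ \<Rightarrow> int" where "c = (\<lambda>k. if k = i then 1 else if k = j then - 1 else 0)"
  have "int_comb G c x I = int_comb G c x {i, j}"
    by (rule int_comb_neutral) (use assms ij in \<open>auto simp: c_def\<close>)
  also have "\<dots> = \<one>"
    using ij assms by (auto simp: int_comb_def c_def Pi_iff int_pow_neg)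
  finally show False
    using assms(3) ij by (auto simp: int_indep_family_def c_def dest!: spec[of _ c])
qed

text \<open>Independence makes the family injective, so its image is an independent set of the same
  size, as the definition of the rank requires.\<close>

lemma card_le_group_rank:
  assumes "finite I" "x \<in> I \<rightarrow> carrier G" "int_indep_family G x I"
  shows "of_nat (card I) \<le> group_rank G"
proof -
  have inj: "inj_on x I"
    using int_indep_family_inj_on assms by blast
  have "int_independent G (x ` I)"
    unfolding int_independent_def
  proof (intro conjI allI impI)
    fix c :: "'a \<Rightarrow> int"
    assume "finprod G (\<lambda>y. y [^] c y) (x ` I) = \<one>"
    then have "int_comb G (c \<circ> x) x I = \<one>"
      unfolding int_comb_def using assms inj by (subst (asm) finprod_reindex) auto
    then show "\<forall>y\<in>x ` I. c y = 0"
      using assms(3) by (auto simp: int_indep_family_def)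
  qed (use assms in auto)
  then show ?thesis
    unfolding group_rank_def by (metis (mono_tags, lifting) SUP_upper card_image inj mem_Collect_eq)
qed

end

lemma hom_int_comb:
  assumes "comm_group G" "comm_group H" "f \<in> hom G H" "x \<in> I \<rightarrow> carrier G"
  shows "f (int_comb G c x I) = int_comb H c (f \<circ> x) I"
proof -
  interpret G: comm_group G by fact
  interpret H: comm_group H by fact
  interpret f: group_hom G H f
    by unfold_locales fact
  show ?thesis
    using assms(4)
    by (induction I rule: infinite_finite_induct)
      (auto simp: int_comb_def Pi_iff f.hom_int_pow)
qed

text \<open>Let \<open>T\<close> be a maximal subset of an independent set \<open>S\<close> of \<open>B\<close> whose image in \<open>C\<close> is
  independent.  For each \<open>s\<close> in \<open>S - T\<close> a nonzero multiple of \<open>s\<close> can be corrected by elements of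
  \<open>T\<close> to lie in the kernel of \<open>g\<close>; the lifts of these elements to \<open>A\<close> are independent.\<close>

lemma group_rank_exact_le:
  assumes A: "comm_group A" and B: "comm_group B" and C: "comm_group C"
    and f: "f \<in> hom A B" and g: "g \<in> hom B C"
    and ex: "kernel B C g \<subseteq> f ` carrier A"
  shows "group_rank B \<le> group_rank A + group_rank C"
proof -
  interpret A: comm_group A by fact
  interpret B: comm_group B by fact
  interpret C: comm_group C by fact
  interpret f: group_hom A B f by unfold_locales fact
  interpret g: group_hom B C g by unfold_locales fact
  have "of_nat (card S) \<le> group_rank A + group_rank C" if S: "int_independent B S" for S
  proof -
    have fin: "finite S" and SB: "S \<subseteq> carrier B"
      and ind: "int_indep_family B id S"
      using S by (auto simp: int_independent_def int_indep_family_def int_comb_def)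
    let ?\<T> = "{T. T \<subseteq> S \<and> int_indep_family C g T}"
    have "finite ?\<T>"
      using fin by auto
    moreover have "{} \<in> ?\<T>"
      by (auto simp: int_indep_family_def)
    ultimately have "\<exists>T\<in>?\<T>. \<forall>U\<in>?\<T>. T \<subseteq> U \<longrightarrow> T = U"
      by (intro finite_has_maximal) blast+
    then obtain T where T: "T \<in> ?\<T>" and max: "\<forall>U\<in>?\<T>. T \<subseteq> U \<longrightarrow> T = U"
      by (rule bexE)
    have TS: "T \<subseteq> S" and finT: "finite T"
      using T fin finite_subset by auto
    have gS: "g \<in> S \<rightarrow> carrier C"
      using SB by auto
    have "of_nat (card T) \<le> group_rank C"
      by (rule C.card_le_group_rank[where x = g]) (use T finT gS TS in auto)
    moreover have "of_nat (card (S - T)) \<le> group_rank A"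
    proof -
      have "\<exists>e. e s \<noteq> 0 \<and> (\<forall>u\<in>S - T. u \<noteq> s \<longrightarrow> e u = 0) \<and> int_comb C e g S = \<one>\<^bsub>C\<^esub>"
        if s: "s \<in> S - T" for s
      proof -
        have "\<not> int_indep_family C g (insert s T)"
          using bspec[OF max, of "insert s T"] s TS by blast
        then obtain c where c: "int_comb C c g (insert s T) = \<one>\<^bsub>C\<^esub>"
          and nz: "\<exists>u\<in>insert s T. c u \<noteq> 0"
          by (auto simp: int_indep_family_def)
        \<comment> \<open>Otherwise the relation would involve only \<open>T\<close>, whose image is
          independent, and \<open>c\<close> would vanish altogether.\<close>
        have "c s \<noteq> 0"
        proof
          assume "c s = 0"
          then have "int_comb C c g (insert s T) = int_comb C c g T"
            using s TS finT gS by (intro C.int_comb_neutral) auto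
          with c T have "\<forall>u\<in>T. c u = 0"
            by (auto simp: int_indep_family_def)
          with nz \<open>c s = 0\<close> show False by auto
        qed
        define e where "e = (\<lambda>u. if u \<in> insert s T then c u else 0)"
        have "int_comb C e g S = int_comb C e g (insert s T)"
          by (rule C.int_comb_neutral) (use s TS fin gS in \<open>auto simp: e_def\<close>)
        also have "\<dots> = int_comb C c g (insert s T)"
          by (rule C.int_comb_cong) (use s TS gS in \<open>auto simp: e_def\<close>)
        finally have "int_comb C e g S = \<one>\<^bsub>C\<^esub>"
          using c by simp
        then show ?thesis
          using \<open>c s \<noteq> 0\<close> by (intro exI[of _ e]) (auto simp: e_def)
      qed
      then obtain e where e: "\<And>s. s \<in> S - T \<Longrightarrow> e s s \<noteq> 0"
        "\<And>s u. s \<in> S - T \<Longrightarrow> u \<in> S - T \<Longrightarrow> u \<noteq> s \<Longrightarrow> e s u = 0"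
        "\<And>s. s \<in> S - T \<Longrightarrow> int_comb C (e s) g S = \<one>\<^bsub>C\<^esub>"
        by metis
      have idS: "id \<in> S \<rightarrow> carrier B"
        using SB by auto
      have "int_comb B (e s) id S \<in> kernel B C g" if "s \<in> S - T" for s
        using e(3)[OF that] hom_int_comb[OF B C g idS, of "e s"] idS by (simp add: kernel_def)
      with ex have "\<forall>s\<in>S - T. \<exists>a. a \<in> carrier A \<and> f a = int_comb B (e s) id S"
        by (metis imageE subsetD)
      then obtain a where a: "\<And>s. s \<in> S - T \<Longrightarrow> a s \<in> carrier A"
        "\<And>s. s \<in> S - T \<Longrightarrow> f (a s) = int_comb B (e s) id S"
        by metis
      have "int_indep_family A a (S - T)"
        unfolding int_indep_family_def
      proof (intro allI impI ballI)
        fix d s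
        assume d: "int_comb A d a (S - T) = \<one>\<^bsub>A\<^esub>" and s: "s \<in> S - T"
        have "\<one>\<^bsub>B\<^esub> = int_comb B d (f \<circ> a) (S - T)"
          using hom_int_comb[OF A B f, of a "S - T" d] d a by auto
        also have "\<dots> = int_comb B d (\<lambda>s. int_comb B (e s) id S) (S - T)"
          by (rule B.int_comb_cong) (use a B.int_comb_closed[OF idS] in auto)
        also have "\<dots> = int_comb B (\<lambda>i. \<Sum>s\<in>S - T. d s * e s i) id S"
          by (rule B.int_comb_int_comb) (use fin idS in auto)
        finally have "(\<Sum>u\<in>S - T. d u * e u s) = 0"
          using ind s by (auto simp: int_indep_family_def)
        \<comment> \<open>On \<open>S - T\<close> the coefficient matrix \<open>e\<close> is
          diagonal with nonzero entries, so only the term \<open>u = s\<close> survives.\<close>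
        also have "(\<Sum>u\<in>S - T. d u * e u s) = (\<Sum>u\<in>S - T. if u = s then d u * e u s else 0)"
          by (rule sum.cong) (use e(2) s in auto)
        also have "\<dots> = d s * e s s"
          using s fin by simp
        finally show "d s = 0"
          using e(1) s by simp
      qed
      then show ?thesis
        by (intro A.card_le_group_rank) (use fin a in auto)
    qed
    moreover have "card S = card (S - T) + card T"
      using TS fin card_mono by (fastforce simp: card_Diff_subset finT)
    ultimately show ?thesis
      by (simp add: add_mono)
  qed
  then show ?thesis
    unfolding group_rank_def[of B] by (auto intro: SUP_least)
qed

lemma group_rank_trivial_group:
  fixes G (structure)
  assumes "trivial_group G"
  shows "group_rank G = 0"
proof -
  interpret group G
    using assms by (simp add: trivial_group_def)
  interpret comm_group G
    by (rule group_comm_groupI) (use assms in \<open>auto simp: trivial_group_def\<close>)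
  have "S = {}" if S: "int_independent G S" for S
  proof (rule ccontr)
    assume "S \<noteq> {}"
    have one: "x = \<one>" if "x \<in> S" for x
      using that S assms by (auto simp: int_independent_def trivial_group_def)
    \<comment> \<open>All coefficients equal to 1 already give a relation, so only the empty set is
      independent.\<close>
    have "finprod G (\<lambda>x. x [^] (1::int)) S = \<one>"
      by (rule finprod_one_eqI) (metis one int_pow_one)
    then have "\<forall>x\<in>S. (1::int) = 0"
      using S unfolding int_independent_def by (elim conjE) (drule spec[of _ "\<lambda>_. 1"], simp)
    with \<open>S \<noteq> {}\<close> show False
      by simp
  qed
  then have "group_rank G \<le> 0"
    unfolding group_rank_def by (intro SUP_least) fastforce
  then show ?thesis
    by simp
qed

text \<open>An injective homomorphism has trivial kernel, so the rank inequality for exact sequences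
  applies with a trivial group, of rank 0, on the left.\<close>

lemma group_rank_mono:
  assumes G: "comm_group G" and H: "comm_group H" and f: "f \<in> mon G H"
  shows "group_rank G \<le> group_rank H"
proof -
  interpret G: comm_group G by fact
  interpret H: comm_group H by fact
  interpret f: group_hom G H f
    using f by unfold_locales (simp add: mon_def)
  have "group_rank G \<le> group_rank (singleton_group \<one>\<^bsub>G\<^esub>) + group_rank H"
  proof (rule group_rank_exact_le[where f = id and g = f])
    show "kernel G H f \<subseteq> id ` carrier (singleton_group \<one>\<^bsub>G\<^esub>)"
      using f f.inj_iff_trivial_ker by (auto simp: mon_def singleton_group_def)
  qed (use assms G.id_hom_singleton in \<open>auto simp: mon_def\<close>)
  then show ?thesis
    by (simp add: group_rank_trivial_group)
qed

lemma group_rank_iso: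
  assumes G: "comm_group G" and H: "comm_group H" and iso: "G \<cong> H"
  shows "group_rank G = group_rank H"
proof (rule antisym)
  show "group_rank G \<le> group_rank H"
    using assms by (auto simp: is_iso_def iso_def mon_def bij_betw_def intro: group_rank_mono)
  have "H \<cong> G"
    using G iso by (simp add: comm_group.axioms(2) group.iso_sym)
  then show "group_rank H \<le> group_rank G"
    using assms by (auto simp: is_iso_def iso_def mon_def bij_betw_def intro: group_rank_mono)
qed

lemma group_rank_integer_group: "group_rank integer_group \<le> 1"
proof -
  interpret comm_group integer_group
    by (rule abelian_integer_group)
  have "card S \<le> 1" if S: "int_independent integer_group S" for S
  proof (rule ccontr)
    assume "\<not> card S \<le> 1"
    then obtain a b where ab: "a \<in> S" "b \<in> S" "a \<noteq> b"
      by (metis S card_le_Suc0_iff_eq int_independent_def One_nat_def)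
    \<comment> \<open>The relation \<open>b * a - a * b = 0\<close> holds for any two integers;
      independence would force \<open>a = b = 0\<close>.\<close>
    define c where "c = (\<lambda>k. if k = a then b else if k = b then - a else 0)"
    have "int_comb integer_group c id S = int_comb integer_group c id {a, b}"
      by (rule int_comb_neutral) (use S ab in \<open>auto simp: c_def int_independent_def\<close>)
    also have "\<dots> = 0"
      using ab finprod_insert[of "{b}" a "\<lambda>i. c i * i"] by (auto simp: int_comb_def c_def Pi_iff)
    finally have "c a = 0 \<and> c b = 0"
      using S ab by (auto simp: int_independent_def int_comb_def)
    with ab show False
      by (auto simp: c_def)
  qed
  then have "of_nat (card S) \<le> (of_nat 1 :: ennreal)" if "int_independent integer_group S" for S
    using that of_nat_mono by blast
  then show ?thesis
    unfolding group_rank_def by (intro SUP_least) simp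
qed

section \<open>The Mayer--Vietoris inequality for Betti numbers\<close>

text \<open>Exactness of the long sequence of the pair at the homology of \<open>X\<close>.\<close>

lemma betti_le_betti_add_relative:
  assumes "S \<subseteq> topspace X"
  shows "betti p X \<le> betti p (subtopology X S) + group_rank (relative_homology_group (int p) X S)"
  unfolding betti_def
proof (rule group_rank_exact_le)
  show "kernel (homology_group (int p) X) (relative_homology_group (int p) X S) (hom_induced (int p) X {} X S id)
      \<subseteq> hom_induced (int p) (subtopology X S) {} X {} id ` carrier (homology_group (int p) (subtopology X S))"
    using homology_exactness_axiom_3[of "int p" X S] by auto
qed (auto intro: hom_induced_hom)

text \<open>Exactness of the same sequence at the relative group, whose next map is the boundary.
  The degree is an integer, so \<open>p - 1\<close> may be negative.\<close>

lemma group_rank_relative_homology_group_le: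
  "group_rank (relative_homology_group p X S)
    \<le> group_rank (homology_group p X) + group_rank (homology_group (p - 1) (subtopology X S))"
proof (rule group_rank_exact_le)
  show "kernel (relative_homology_group p X S) (homology_group (p - 1) (subtopology X S)) (hom_boundary p X S)
      \<subseteq> hom_induced p X {} X S id ` carrier (homology_group p X)"
    using homology_exactness_axiom_1[of p X S] by auto
qed (auto intro: hom_induced_hom hom_boundary_hom)

text \<open>The excised set is \<open>A - B\<close>: it is closed in the union because
  \<open>B\<close> is open, and it lies in the open set \<open>A\<close>, so its closure lies in the
  interior of \<open>A\<close>.\<close>

lemma excision_open_Un:
  fixes A B :: "'a::topological_space set"
  assumes "open A" "open B"
  shows "relative_homology_group p (top_of_set B) (A \<inter> B)
    \<cong> relative_homology_group p (top_of_set (A \<union> B)) A"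
proof -
  let ?X = "top_of_set (A \<union> B)"
  have "closedin ?X ((A \<union> B) - B)"
    using assms by (intro closedin_diff) (auto intro: open_openin_trans)
  moreover have "(A \<union> B) - B = A - B"
    by blast
  moreover have "openin ?X A"
    using assms by (auto intro: open_openin_trans)
  ultimately have "?X closure_of (A - B) \<subseteq> ?X interior_of A"
    by (simp add: closure_of_closedin interior_of_openin)
  then have "hom_induced p (subtopology ?X ((A \<union> B) - (A - B))) (A - (A - B)) (subtopology ?X (A \<union> B)) A id
      \<in> iso (relative_homology_group p (subtopology ?X ((A \<union> B) - (A - B))) (A - (A - B)))
            (relative_homology_group p (subtopology ?X (A \<union> B)) A)"
    by (rule homology_excision_axiom) auto
  moreover have "(A \<union> B) - (A - B) = B" "A - (A - B) = A \<inter> B" "(A \<union> B) \<inter> B = B"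
    by blast+
  ultimately show ?thesis
    by (auto simp: subtopology_subtopology is_iso_def)
qed

text \<open>The sequence of the pair \<open>(A \<union> B, A)\<close> is followed by excision to
  \<open>(B, A \<inter> B)\<close> and the sequence of that pair; the boundary map accounts for the
  drop in degree.\<close>

lemma betti_Un_le:
  fixes A B :: "'a::topological_space set"
  assumes "open A" "open B"
  shows "betti p (top_of_set (A \<union> B)) \<le> betti p (top_of_set A) + (betti p (top_of_set B)
           + group_rank (homology_group (int p - 1) (top_of_set (A \<inter> B))))"
proof -
  have "group_rank (relative_homology_group (int p) (top_of_set (A \<union> B)) A)
      = group_rank (relative_homology_group (int p) (top_of_set B) (A \<inter> B))"
    by (rule group_rank_iso[symmetric]) (simp_all add: excision_open_Un assms)
  moreover have "B \<inter> (A \<inter> B) = A \<inter> B" "(A \<union> B) \<inter> A = A"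
    by blast+
  ultimately show ?thesis
    using betti_le_betti_add_relative[of A "top_of_set (A \<union> B)" p]
      group_rank_relative_homology_group_le[of "int p" "top_of_set B" "A \<inter> B"]
    by (auto simp: subtopology_subtopology betti_def intro: order_trans add_left_mono)
qed

lemma total_betti_Un_le:
  fixes A B :: "'a::topological_space set"
  assumes "open A" "open B"
  shows "total_betti (A \<union> B) \<le> total_betti A + (total_betti B + total_betti (A \<inter> B))"
  unfolding total_betti_def
proof (rule suminf_le_const)
  fix n
  define h where "h p = group_rank (homology_group (int p - 1) (top_of_set (A \<inter> B)))" for p
  have "h 0 = 0"
    by (simp add: h_def group_rank_trivial_group)
  moreover have "h (Suc p) = betti p (top_of_set (A \<inter> B))" for p
    by (simp add: h_def betti_def)
  ultimately have "sum h {..<Suc n} = (\<Sum>p<n. betti p (top_of_set (A \<inter> B)))"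
    by (simp add: sum.lessThan_Suc_shift del: sum.lessThan_Suc)
  then have "sum h {..<n} \<le> suminf (\<lambda>p. betti p (top_of_set (A \<inter> B)))"
    by (metis (no_types, lifting) sum_le_suminf[OF summableI, of "{..<n}"] finite_lessThan
        le_iff_add order_trans sum.lessThan_Suc zero_le)
  moreover have "(\<Sum>p<n. betti p (top_of_set (A \<union> B)))
      \<le> (\<Sum>p<n. betti p (top_of_set A)) + ((\<Sum>p<n. betti p (top_of_set B)) + sum h {..<n})"
    unfolding sum.distrib[symmetric] h_def
    by (rule sum_mono) (rule betti_Un_le[OF assms])
  ultimately show "(\<Sum>p<n. betti p (top_of_set (A \<union> B))) \<le> suminf (\<lambda>p. betti p (top_of_set A))
      + (suminf (\<lambda>p. betti p (top_of_set B)) + suminf (\<lambda>p. betti p (top_of_set (A \<inter> B))))"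
    by (elim order_trans) (intro add_mono sum_le_suminf summableI, auto)
qed (rule summableI)

section \<open>Convex sets, retracts and unions of convex sets\<close>

lemma total_betti_empty [simp]: "total_betti {} = 0"
  by (simp add: total_betti_def betti_def group_rank_trivial_group trivial_homology_group_empty)

text \<open>A nonempty convex set is contractible, which kills positive degrees, and path connected,
  which makes degree 0 infinite cyclic.\<close>

lemma total_betti_convex_le:
  fixes S :: "'a::real_normed_vector set"
  assumes "convex S"
  shows "total_betti S \<le> 1"
proof (cases "S = {}")
  case False
  have "betti p (top_of_set S) = 0" if "p \<noteq> 0" for p
  proof -
    obtain a where a: "a \<in> S" "top_of_set S homotopy_equivalent_space top_of_set {a}"
      using contractible_eq_homotopy_equivalent_singleton_subtopology[of "top_of_set S"]
        convex_imp_contractible[OF assms] False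
      by (metis contractible_space_top_of_set inf.absorb_iff2 insert_subset empty_subsetI
          null_topspace_iff_trivial subtopology_subtopology topspace_euclidean_subtopology)
    then have "homology_group (int p) (top_of_set S) \<cong> homology_group (int p) (top_of_set {a})"
      by (simp add: homotopy_equivalent_space_imp_isomorphic_homology_groups)
    moreover have "trivial_group (homology_group (int p) (top_of_set {a}))"
      using that by (intro homology_dimension_axiom) auto
    ultimately show ?thesis
      by (simp add: betti_def group_rank_trivial_group isomorphic_group_triviality)
  qed
  then have "total_betti S = betti 0 (top_of_set S)"
    unfolding total_betti_def by (subst suminf_finite[of "{0}"]) auto
  also have "\<dots> = group_rank integer_group"
    unfolding betti_def
  proof (rule group_rank_iso)
    have "path_connected_space (top_of_set S)"
      by (simp add: assms convex_imp_path_connected)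
    then show "homology_group (int 0) (top_of_set S) \<cong> integer_group"
      using False isomorphic_integer_zeroth_homology_group[of "top_of_set S"]
      by (metis of_nat_0 topspace_euclidean_subtopology)
  qed (auto simp: abelian_integer_group)
  finally show ?thesis
    using group_rank_integer_group by simp
qed simp

text \<open>The inclusion of a retract is injective on homology in every degree.\<close>

lemma total_betti_retract_le:
  assumes "S retract_of_space (top_of_set T)"
  shows "total_betti S \<le> total_betti T"
proof -
  have ST: "T \<inter> S = S"
    using retract_of_space_imp_subset[OF assms] by auto
  have "betti p (top_of_set S) \<le> betti p (top_of_set T)" for p
    using inj_on_hom_induced_inclusion[of S "top_of_set T" "int p"] assms ST
    by (auto simp: betti_def subtopology_subtopology mon_def intro!: group_rank_mono
        hom_induced_hom)
  then show ?thesis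
    unfolding total_betti_def by (intro suminf_le summableI)
qed

text \<open>The sets \<open>U j \<inter> U i\<close> are again open and convex, so the induction is
  over all families \<open>U\<close> and applies to them as well. The summand 1 absorbs the
  contribution of the new set, so that each step just doubles the bound.\<close>

lemma total_betti_UN_convex_le:
  fixes U :: "'i \<Rightarrow> 'a::real_normed_vector set"
  assumes "finite I" "\<And>i. i \<in> I \<Longrightarrow> open (U i)" "\<And>i. i \<in> I \<Longrightarrow> convex (U i)"
  shows "total_betti (\<Union>i\<in>I. U i) + 1 \<le> 2 ^ card I"
  using assms
proof (induction I arbitrary: U)
  case (insert i I)
  have "(\<Union>j\<in>insert i I. U j) = (\<Union>j\<in>I. U j) \<union> U i" "(\<Union>j\<in>I. U j) \<inter> U i = (\<Union>j\<in>I. U j \<inter> U i)"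
    by blast+
  then have "total_betti (\<Union>j\<in>insert i I. U j)
      \<le> total_betti (\<Union>j\<in>I. U j) + (total_betti (U i) + total_betti (\<Union>j\<in>I. U j \<inter> U i))"
    using total_betti_Un_le[OF open_UN, of I U "U i"] insert.prems by simp
  also have "\<dots> \<le> total_betti (\<Union>j\<in>I. U j) + (1 + total_betti (\<Union>j\<in>I. U j \<inter> U i))"
    by (intro add_mono total_betti_convex_le insert.prems) auto
  finally have "total_betti (\<Union>j\<in>insert i I. U j) + 1
      \<le> (total_betti (\<Union>j\<in>I. U j) + 1) + (total_betti (\<Union>j\<in>I. U j \<inter> U i) + 1)"
    by (simp add: ac_simps)
  also have "\<dots> \<le> 2 ^ card I + 2 ^ card I"
    using insert.prems by (intro add_mono insert.IH) (auto intro: convex_Int)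
  finally show ?case
    using insert by (simp add: mult_2)
qed simp

text \<open>Adding one set to the union costs only a bounded amount, since the new set meets the union in
  at most \<open>M\<close> convex pieces.\<close>

lemma total_betti_UN_bounded_overlap_le:
  fixes U :: "'i \<Rightarrow> 'a::real_normed_vector set"
  assumes "finite I" "\<And>i. i \<in> I \<Longrightarrow> open (U i)" "\<And>i. i \<in> I \<Longrightarrow> convex (U i)"
    and "\<And>i. i \<in> I \<Longrightarrow> card {j\<in>I. U j \<inter> U i \<noteq> {}} \<le> M"
  shows "total_betti (\<Union>i\<in>I. U i) \<le> of_nat (card I) * (1 + 2 ^ M)"
  using assms
proof (induction I)
  case (insert i I)
  let ?J = "{j\<in>I. U j \<inter> U i \<noteq> {}}"
  have overlap: "card {j\<in>I. U j \<inter> U k \<noteq> {}} \<le> M" if "k \<in> insert i I" for k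
  proof -
    have "card {j\<in>I. U j \<inter> U k \<noteq> {}} \<le> card {j\<in>insert i I. U j \<inter> U k \<noteq> {}}"
      using insert.hyps by (intro card_mono) auto
    with insert.prems(3)[OF that] show ?thesis by simp
  qed
  have "total_betti (\<Union>j\<in>?J. U j \<inter> U i) \<le> total_betti (\<Union>j\<in>?J. U j \<inter> U i) + 1"
    by simp
  also have "\<dots> \<le> 2 ^ card ?J"
    using insert.hyps insert.prems by (intro total_betti_UN_convex_le) (auto intro: convex_Int)
  also have "\<dots> \<le> 2 ^ M"
    using overlap[of i] by (intro power_increasing) auto
  finally have *: "total_betti (\<Union>j\<in>?J. U j \<inter> U i) \<le> 2 ^ M" .
  have "(\<Union>j\<in>insert i I. U j) = (\<Union>j\<in>I. U j) \<union> U i" "(\<Union>j\<in>I. U j) \<inter> U i = (\<Union>j\<in>?J. U j \<inter> U i)"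
    by blast+
  then have "total_betti (\<Union>j\<in>insert i I. U j)
      \<le> total_betti (\<Union>j\<in>I. U j) + (total_betti (U i) + total_betti (\<Union>j\<in>?J. U j \<inter> U i))"
    using total_betti_Un_le[OF open_UN, of I U "U i"] insert.prems by simp
  also have "\<dots> \<le> of_nat (card I) * (1 + 2 ^ M) + (1 + 2 ^ M)"
    using * overlap insert.prems by (intro add_mono total_betti_convex_le insert.IH) auto
  finally show ?case
    using insert.hyps by (simp add: distrib_right add.commute)
qed simp

section \<open>Nearest-point retraction and grid boxes\<close>

text \<open>By uniqueness, the graph of the projection is the set of pairs in
  \<open>T \<times> Z\<close> where \<open>dist x z - infdist x Z\<close> vanishes, hence closed. A
  map into a compact set with closed graph is continuous.\<close>

lemma nearest_point_retract_of_space: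
  fixes Z T :: "'a::euclidean_space set"
  assumes "compact Z" "Z \<subseteq> T"
    and nearest: "\<And>x. x \<in> T \<Longrightarrow> \<exists>!z. z \<in> Z \<and> infdist x Z = dist x z"
  shows "Z retract_of_space (top_of_set T)"
proof -
  obtain f where f: "\<And>x. x \<in> T \<Longrightarrow> f x \<in> Z \<and> infdist x Z = dist x (f x)"
    using nearest by metis
  have eq: "(\<lambda>x. (x, f x)) ` T = {y \<in> T \<times> Z. dist (fst y) (snd y) - infdist (fst y) Z = 0}"
    using f nearest by force
  have "closedin (top_of_set (T \<times> Z)) ((\<lambda>x. (x, f x)) ` T)"
    unfolding eq
    by (rule continuous_closedin_preimage_constant) (intro continuous_intros)
  then have "continuous_on T f"
    using f by (subst continuous_closed_graph_eq[OF \<open>compact Z\<close>]) auto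
  moreover have "f x = x" if "x \<in> Z" for x
    using f[of x] that \<open>Z \<subseteq> T\<close> by auto
  ultimately show ?thesis
    using assms(2) f by (auto simp: retract_of_space_def subtopology_subtopology Int_absorb1
        continuous_map_in_subtopology intro!: exI[of _ f])
qed

text \<open>The centres are \<open>e\<close> apart and the half-side is also \<open>e\<close>, so
  neighbours overlap and these open cubes cover the space.\<close>

definition grid_box :: "real \<Rightarrow> ('n \<Rightarrow> int) \<Rightarrow> (real ^ 'n) set" where
  "grid_box e k = {x. \<forall>i. \<bar>x $ i - e * of_int (k i)\<bar> < e}"

lemma grid_box_eq: "grid_box e k = (\<Inter>i. (\<lambda>x. x $ i) -` ball (e * of_int (k i)) e)"
  by (auto simp: grid_box_def dist_real_def abs_minus_commute)

lemma open_grid_box: "open (grid_box e k)"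
  unfolding grid_box_eq by (intro open_INT ballI open_vimage continuous_intros) auto

lemma convex_grid_box: "convex (grid_box e k)"
  unfolding grid_box_eq
  by (intro convex_INT convex_linear_vimage)
    (auto intro: bounded_linear.linear bounded_linear_vec_nth)

lemma mem_grid_box_floor:
  assumes "e > 0"
  shows "x \<in> grid_box e (\<lambda>i. \<lfloor>x $ i / e\<rfloor>)"
proof -
  have "\<bar>x $ i - e * of_int \<lfloor>x $ i / e\<rfloor>\<bar> < e" for i
  proof -
    have "x $ i / e - of_int \<lfloor>x $ i / e\<rfloor> \<in> {0..<1}"
      by (auto simp: less_diff_eq) linarith+
    moreover have "x $ i - e * of_int \<lfloor>x $ i / e\<rfloor> = e * (x $ i / e - of_int \<lfloor>x $ i / e\<rfloor>)"
      using assms by (simp add: field_simps)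
    ultimately show ?thesis
      using assms by (auto simp: abs_mult)
  qed
  then show ?thesis
    by (simp add: grid_box_def)
qed

lemma dist_less_grid_box:
  fixes x y :: "real ^ 'n"
  assumes "x \<in> grid_box e k" "y \<in> grid_box e k"
  shows "dist x y < 2 * e * real CARD('n)"
proof -
  have "dist x y \<le> (\<Sum>i\<in>UNIV. \<bar>(x - y) $ i\<bar>)"
    unfolding dist_norm by (rule norm_le_l1_cart)
  also have "\<dots> < (\<Sum>i\<in>(UNIV :: 'n set). 2 * e)"
  proof (rule sum_strict_mono)
    fix i
    have "\<bar>x $ i - e * of_int (k i)\<bar> < e" "\<bar>y $ i - e * of_int (k i)\<bar> < e"
      using assms by (auto simp: grid_box_def)
    then show "\<bar>(x - y) $ i\<bar> < 2 * e"
      by simp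
  qed auto
  finally show ?thesis
    by (simp add: mult.commute)
qed

lemma finite_bounded_fun:
  fixes l u :: "'n::finite \<Rightarrow> int"
  shows "finite {k. \<forall>i. l i \<le> k i \<and> k i \<le> u i}"
proof -
  have "{k. \<forall>i. l i \<le> k i \<and> k i \<le> u i} = PiE UNIV (\<lambda>i. {l i..u i})"
    by (auto simp: PiE_iff)
  then show ?thesis
    by (simp add: finite_PiE)
qed

lemma card_bounded_fun:
  fixes l :: "'n::finite \<Rightarrow> int"
  shows "card {k. \<forall>i. l i \<le> k i \<and> k i \<le> l i + int m} = (m + 1) ^ CARD('n)"
proof -
  have "{k. \<forall>i. l i \<le> k i \<and> k i \<le> l i + int m} = PiE UNIV (\<lambda>i. {l i..l i + int m})"
    by (auto simp: PiE_iff)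
  then show ?thesis
    by (simp add: card_PiE nat_add_distrib)
qed

text \<open>If two boxes meet, their centres differ by less than \<open>2 * e\<close> in each
  coordinate, hence their indices by at most 1: three choices per coordinate.\<close>

lemma card_grid_box_overlap:
  fixes k :: "'n::finite \<Rightarrow> int"
  assumes "e > 0"
  shows "card {j\<in>J. grid_box e j \<inter> grid_box e k \<noteq> {}} \<le> 3 ^ CARD('n)"
proof -
  have "{j\<in>J. grid_box e j \<inter> grid_box e k \<noteq> {}} \<subseteq> {j. \<forall>i. k i - 1 \<le> j i \<and> j i \<le> (k i - 1) + int 2}"
  proof clarify
    fix j i
    assume "grid_box e j \<inter> grid_box e k \<noteq> {}"
    then obtain x where "\<bar>x $ i - e * of_int (j i)\<bar> < e" "\<bar>x $ i - e * of_int (k i)\<bar> < e"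
      by (auto simp: grid_box_def)
    then have "\<bar>e * of_int (j i) - e * of_int (k i)\<bar> < e * 2"
      by linarith
    also have "\<bar>e * of_int (j i) - e * of_int (k i)\<bar> = e * of_int \<bar>j i - k i\<bar>"
      using assms by (simp add: abs_mult flip: right_diff_distrib of_int_diff)
    finally have "\<bar>j i - k i\<bar> < 2"
      using assms by simp
    then show "k i - 1 \<le> j i \<and> j i \<le> (k i - 1) + int 2"
      by linarith
  qed
  then have "card {j\<in>J. grid_box e j \<inter> grid_box e k \<noteq> {}} \<le> (2 + 1) ^ CARD('n)"
    unfolding card_bounded_fun[where l = "\<lambda>i. k i - 1" and m = 2, symmetric]
    by (intro card_mono finite_bounded_fun)
  then show ?thesis
    by simp
qed

lemma card_grid_boxes_meeting:
  fixes Z :: "(real ^ 'n) set"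
  assumes "e > 0" "e \<le> 1" "\<And>z. z \<in> Z \<Longrightarrow> norm z \<le> L" "0 \<le> L"
  shows "finite {k. grid_box e k \<inter> Z \<noteq> {}}"
    and "real (card {k. grid_box e k \<inter> Z \<noteq> {}}) \<le> ((2 * L + 5) / e) ^ CARD('n)"
proof -
  \<comment> \<open>A box meeting \<open>Z\<close> has a point with coordinates at most
    \<open>L\<close> in absolute value within \<open>e\<close> of its centre, so its indices are
    below \<open>L / e + 1\<close> in absolute value.\<close>
  define m where "m = nat \<lceil>L / e + 1\<rceil>"
  let ?B = "{k :: 'n \<Rightarrow> int. \<forall>i. - int m \<le> k i \<and> k i \<le> - int m + int (2 * m)}"
  have sub: "{k. grid_box e k \<inter> Z \<noteq> {}} \<subseteq> ?B"
  proof clarify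
    fix k i
    assume "grid_box e k \<inter> Z \<noteq> {}"
    then obtain z where z: "z \<in> Z" "\<bar>z $ i - e * of_int (k i)\<bar> < e"
      by (auto simp: grid_box_def)
    have "\<bar>z $ i\<bar> \<le> L"
      using component_le_norm_cart[of z i] assms(3)[OF z(1)] by linarith
    then have "\<bar>e * of_int (k i)\<bar> < e * (L / e + 1)"
      using z(2) assms(1) by (simp add: distrib_left)
    then have "\<bar>of_int (k i)\<bar> < L / e + 1"
      using assms(1) by (simp add: abs_mult)
    then show "- int m \<le> k i \<and> k i \<le> - int m + int (2 * m)"
      unfolding m_def by linarith
  qed
  show "finite {k. grid_box e k \<inter> Z \<noteq> {}}"
    by (rule finite_subset[OF sub finite_bounded_fun])
  have "card {k. grid_box e k \<inter> Z \<noteq> {}} \<le> (2 * m + 1) ^ CARD('n)"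
    unfolding card_bounded_fun[where l = "\<lambda>i. - int m" and m = "2 * m", symmetric]
    by (intro card_mono finite_bounded_fun sub)
  then have "real (card {k. grid_box e k \<inter> Z \<noteq> {}}) \<le> real (2 * m + 1) ^ CARD('n)"
    by (metis of_nat_le_iff of_nat_power)
  \<comment> \<open>Rounding up gives \<open>m \<le> L / e + 2\<close>, hence
    \<open>2 * m + 1 \<le> 2 * L / e + 5\<close>; the 5 becomes \<open>5 / e\<close> because
    \<open>e \<le> 1\<close>.\<close>
  also have "\<dots> \<le> ((2 * L + 5) / e) ^ CARD('n)"
  proof (rule power_mono)
    have "L / e \<ge> 0"
      using assms by simp
    then have "real m \<le> L / e + 2"
      unfolding m_def by linarith
    moreover have "1 \<le> 1 / e"
      using assms by simp
    ultimately have "real (2 * m + 1) \<le> 2 * (L / e) + 5 * (1 / e)"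
      by simp
    then show "real (2 * m + 1) \<le> (2 * L + 5) / e"
      by (simp add: add_divide_distrib)
  qed simp
  finally show "real (card {k. grid_box e k \<inter> Z \<noteq> {}}) \<le> ((2 * L + 5) / e) ^ CARD('n)" .
qed

section \<open>From unique nearest points and positive reach to the bound\<close>

lemma total_betti_le_of_unique_nearest:
  fixes Z :: "(real ^ 'n) set"
  assumes "compact Z" "\<And>z. z \<in> Z \<Longrightarrow> norm z \<le> L" "0 \<le> L" "0 < r" "r \<le> 1"
    and nearest: "\<And>x. Z \<noteq> {} \<Longrightarrow> infdist x Z < r \<Longrightarrow> \<exists>!z. z \<in> Z \<and> infdist x Z = dist x z"
  shows "total_betti Z
    \<le> ennreal (((2 * L + 5) * (2 * real CARD('n)) * (1 / r)) ^ CARD('n) * (1 + 2 ^ 3 ^ CARD('n)))"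
proof -
  \<comment> \<open>With this mesh the bound \<open>2 * e * CARD('n)\<close> on distances within a
    box equals \<open>r\<close>, so every box meeting \<open>Z\<close> stays within distance
    \<open>r\<close> of \<open>Z\<close>.\<close>
  define e where "e = r / (2 * real CARD('n))"
  have card: "real CARD('n) \<ge> 1"
    by (simp add: Suc_leI)
  have e: "e > 0" "2 * e * real CARD('n) = r"
    using assms(4) by (auto simp: e_def)
  have "e \<le> r / 1"
    unfolding e_def using card assms(4) by (intro divide_left_mono) linarith+
  then have "e \<le> 1"
    using assms(5) by simp
  define I where "I = {k. grid_box e k \<inter> Z \<noteq> {}}"
  define K where "K = (\<Union>k\<in>I. grid_box e k)"
  have fin: "finite I" and cardI: "real (card I) \<le> ((2 * L + 5) / e) ^ CARD('n)"
    using card_grid_boxes_meeting[OF e(1) \<open>e \<le> 1\<close>] assms(2,3) unfolding I_def by auto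
  have "Z \<subseteq> K"
    using mem_grid_box_floor[OF e(1)] unfolding K_def I_def by blast
  moreover have "\<exists>!z. z \<in> Z \<and> infdist x Z = dist x z" if "x \<in> K" for x
  proof -
    obtain k z where kz: "x \<in> grid_box e k" "z \<in> grid_box e k" "z \<in> Z"
      using \<open>x \<in> K\<close> unfolding K_def I_def by blast
    then have "infdist x Z < r"
      using dist_less_grid_box[OF kz(1,2)] infdist_le[OF kz(3), of x] e(2) by linarith
    then show ?thesis
      using nearest kz(3) by blast
  qed
  ultimately have "Z retract_of_space (top_of_set K)"
    by (intro nearest_point_retract_of_space assms(1))
  then have "total_betti Z \<le> total_betti K"
    by (rule total_betti_retract_le)
  also have "\<dots> \<le> of_nat (card I) * (1 + 2 ^ 3 ^ CARD('n))"
    unfolding K_def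
    by (intro total_betti_UN_bounded_overlap_le fin open_grid_box convex_grid_box
        card_grid_box_overlap e(1))
  also have "\<dots> = ennreal (real (card I) * (1 + 2 ^ 3 ^ CARD('n)))"
    by (simp add: ennreal_mult ennreal_of_nat_eq_real_of_nat ennreal_plus flip: ennreal_power)
  also have "\<dots> \<le> ennreal (((2 * L + 5) / e) ^ CARD('n) * (1 + 2 ^ 3 ^ CARD('n)))"
    by (intro ennreal_leI mult_right_mono cardI) simp
  also have "(2 * L + 5) / e = (2 * L + 5) * (2 * real CARD('n)) * (1 / r)"
    by (simp add: e_def)
  finally show ?thesis .
qed

lemma reach_unique_nearest:
  fixes Z :: "'a::metric_space set"
  assumes "reach Z > 0"
  obtains r where "0 < r" "r \<le> 1" "ennreal (1 / r) \<le> 2 * (1 + 1 / reach Z)"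
    "\<And>x. Z \<noteq> {} \<Longrightarrow> infdist x Z < r \<Longrightarrow> \<exists>!z. z \<in> Z \<and> infdist x Z = dist x z"
proof -
  have nearest: "\<exists>!z. z \<in> Z \<and> infdist x Z = dist x z"
    if "ennreal r < reach Z" "Z \<noteq> {}" "infdist x Z < r" for r x
  proof -
    \<comment> \<open>\<open>ennreal\<close> sends negative reals to 0, so a comparison in
      \<open>ennreal\<close> is turned into one of reals only after the sign of \<open>r\<close> is
      known.\<close>
    have "r \<ge> 0"
      using that(3) infdist_nonneg[of x Z] by linarith
    from that(1) obtain s where s: "ennreal r < ennreal s" "\<forall>x. Z \<noteq> {} \<and> infdist x Z < s \<longrightarrow>
        (\<exists>!z. z \<in> Z \<and> infdist x Z = dist x z)"
      unfolding reach_def less_Sup_iff by (elim bexE CollectE exE conjE) simp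
    then have "infdist x Z < s"
      using that(3) \<open>r \<ge> 0\<close> by (simp add: ennreal_less_iff)
    with s that(2) show ?thesis
      by blast
  qed
  show thesis
  proof (cases "reach Z")
    case (real \<rho>)
    with assms have "\<rho> > 0"
      by simp
    \<comment> \<open>Halving keeps \<open>r\<close> strictly below the supremum defining the reach,
      and the cap at 1 serves the box count. Then \<open>1 / r\<close> is the larger of 1 and
      \<open>2 / \<rho>\<close>.\<close>
    define r where "r = min 1 (\<rho> / 2)"
    have r: "0 < r" "r \<le> 1" "r < \<rho>"
      using \<open>\<rho> > 0\<close> by (auto simp: r_def)
    have "1 / r \<le> 2 * (1 + 1 / \<rho>)"
      using \<open>\<rho> > 0\<close> by (auto simp: r_def min_def field_simps)
    moreover have "ennreal (2 * (1 + 1 / \<rho>)) = 2 * (1 + 1 / reach Z)"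
      using \<open>\<rho> > 0\<close> real divide_ennreal[of 1 \<rho>]
      by (simp add: ennreal_mult ennreal_plus del: times_divide_eq_right distrib_left_numeral)
    ultimately have "ennreal (1 / r) \<le> 2 * (1 + 1 / reach Z)"
      by (metis ennreal_leI)
    moreover have "ennreal r < reach Z"
      using r real by (simp add: ennreal_less_iff)
    ultimately show thesis
      using that[OF r(1,2)] nearest by blast
  next
    \<comment> \<open>Infinite reach, which includes the empty set: here
      \<open>1 / reach Z = 0\<close> and \<open>r = 1\<close> works.\<close>
    case top
    then show thesis
      using that[of 1] nearest[of 1] by auto
  qed
qed

theorem corollary188:
  fixes D :: "(real ^ 'n) set"
  assumes "\<exists>a R. R > 0 \<and> D = cball a R"
  shows "\<exists>c\<^sub>2::real. c\<^sub>2 > 0 \<and>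
           (\<forall>Z. C1_compact_hypersurface Z \<and> Z \<subseteq> D \<and> reach Z > 0 \<longrightarrow>
                total_betti Z \<le> ennreal c\<^sub>2 * (1 + 1 / reach Z) ^ CARD('n))"
proof -
  obtain a R where D: "R > 0" "D = cball a R"
    using assms by blast
  \<comment> \<open>The grid is based at the origin, so \<open>D\<close> is enclosed in the ball of
    radius \<open>L\<close> around it.\<close>
  define L where "L = norm a + R"
  have "L > 0"
    using D by (simp add: L_def add_nonneg_pos)
  have norm_le: "norm z \<le> L" if "z \<in> D" for z
    using that norm_triangle_ineq[of a "z - a"] by (simp add: D L_def dist_norm norm_minus_commute)
  define b where "b = (2 * L + 5) * (2 * real CARD('n))"
  have "b > 0"
    using \<open>L > 0\<close> by (simp add: b_def)
  define q where "q = (1 + 2 ^ 3 ^ CARD('n) :: real)"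
  have "q > 0"
    by (simp add: q_def add_pos_pos)
  \<comment> \<open>\<open>b\<close> comes from the number of boxes at the chosen mesh, the 2 from
    \<open>1 / r \<le> 2 * (1 + 1 / reach Z)\<close>, and \<open>q\<close> is the cost of adding one
    box; all depend only on \<open>D\<close> and the dimension.\<close>
  let ?c = "(b * 2) ^ CARD('n) * q"
  have "total_betti Z \<le> ennreal ?c * (1 + 1 / reach Z) ^ CARD('n)"
    if Z: "C1_compact_hypersurface Z" "Z \<subseteq> D" "reach Z > 0" for Z
  proof -
    obtain r where r: "0 < r" "r \<le> 1" "ennreal (1 / r) \<le> 2 * (1 + 1 / reach Z)"
      "\<And>x. Z \<noteq> {} \<Longrightarrow> infdist x Z < r \<Longrightarrow> \<exists>!z. z \<in> Z \<and> infdist x Z = dist x z"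
      using reach_unique_nearest[OF Z(3)] by metis
    define s where "s = 1 / r"
    have "s \<ge> 0"
      using r(1) by (simp add: s_def)
    have "compact Z"
      using Z(1) by (simp add: C1_compact_hypersurface_def)
    then have "total_betti Z \<le> ennreal ((b * s) ^ CARD('n) * q)"
      unfolding b_def q_def s_def
      using total_betti_le_of_unique_nearest[of Z L r] norm_le Z(2) \<open>L > 0\<close> r by auto
    also have "\<dots> = ennreal q * (ennreal b * ennreal s) ^ CARD('n)"
      using \<open>b > 0\<close> \<open>q > 0\<close> \<open>s \<ge> 0\<close>
      by (subst mult.commute) (simp add: ennreal_mult flip: ennreal_power)
    also have "\<dots> \<le> ennreal q * (ennreal b * (2 * (1 + 1 / reach Z))) ^ CARD('n)"
      by (intro mult_left_mono power_mono r(3)[folded s_def]) auto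
    also have "\<dots> = ennreal ?c * (1 + 1 / reach Z) ^ CARD('n)"
      using \<open>b > 0\<close> \<open>q > 0\<close>
      by (simp add: ennreal_mult power_mult_distrib mult_ac del: distrib_left_numeral flip: ennreal_power)
    finally show ?thesis .
  qed
  moreover have "?c > 0"
    using \<open>b > 0\<close> \<open>q > 0\<close> by simp
  ultimately show ?thesis
    by blast
qed

end
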